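(* Assume that $\Omega=\mathbb{R}^n$ and that the step-size $\lambda>0$ satisfies $\lambda\le\frac{2\sigma_\omega}{L}$. Then, for the sequence $\{x_k\}_{k=1}^T$ generated by the inexact online proximal mirror descent described in the context with an initial point $x_0\in\Omega$, the dynamic regret satisfies $$R_T=\sum_{k=1}^T\big(f_k(x_k)-f_k(x_k^* )\big)=O\Big(1+P_T+\bar\Sigma_T+(E_T+P_T+\Sigma_T)^2\Big).$$
   Context: Norms are Euclidean. Loss functions: $f_k=g_k+h_k$ for $k=1,2,\dots$, where $g_k:\mathbb{R}^n\to\mathbb{R}$ is a closed, convex and proper function with $L_k$-Lipschitz continuous gradient, and $h_k:\mathbb{R}^n\to\mathbb{R}$ is convex and $B_k$-Lipschitz continuous (possibly non-smooth). Put $L=\max_{1\le k\le T}L_k$ and $B=\max_{1\le k\le T}B_k$. Bregman divergence: $\omega:\mathbb{R}^n\to\mathbb{R}$ is $\sigma_\omega$-strongly convex and has $G_\omega$-Lipschitz gradient, and $$V_\omega(x,y)=\omega(x)-\omega(y)-\langle\nabla\omega(y),x-y\rangle .$$ Algorithm (inexact online proximal mirror descent): given gradient errors $e_k\in\mathbb{R}^n$ and positive constants $\epsilon_k$, for $k=1,\dots,T$ let $$y_k=\arg\min_{x\in\Omega}\Big\{h_k(x)+\langle\nabla g_k(x_{k-1})+e_k,x\rangle+\tfrac1\lambda V_\omega(x,x_{k-1})\Big\},$$ and let $x_k\in\Omega$ be a point with $\|x_k-y_k\|\le\epsilon_k$. For $k\ge1$, $x_k^*\in\Omega$ is an optimal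 point (minimizer over $\Omega$) of $f_k$; $x_0^*\in\Omega$ is a fixed reference point (the optimal point at time $0$). Notation: $\Sigma_T=\sum_{k=1}^T\|x_k^*-x_{k-1}^*\|$, $\bar\Sigma_T=\sum_{k=1}^T\|x_k^*-x_{k-1}^*\|^2$, $E_T=\sum_{k=1}^T\|e_k\|$, $P_T=\sum_{k=1}^T\epsilon_k$.
   Formalization: The step-size condition is strict, λL < 2σ_ω: at λ = 2σ_ω/L the claim is false, since for ω = σ_ω|x|²/2, g_k = L|x|²/2, h_k = 0 and no gradient errors the exact step is x ↦ −x, so the regret grows linearly in T while the bound stays bounded. *)

theory Defs
  imports "HOL-Analysis.Analysis"
begin

text \<open>The total operator \<open>grad f\<close> is only meaningful where \<open>f\<close> is differentiable.\<close>

definition grad :: "('a::real_inner \<Rightarrow> real) \<Rightarrow> 'a \<Rightarrow> 'a" where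
  "grad f x = (THE D. GDERIV f x :> D)"

definition lipschitz_gradient :: "real \<Rightarrow> ('a::real_inner \<Rightarrow> real) \<Rightarrow> bool" where
  "lipschitz_gradient K f \<longleftrightarrow> (\<forall>x. f differentiable (at x)) \<and> K-lipschitz_on UNIV (grad f)"

text \<open>Standard normalisation of the modulus: \<open>\<lambda>x. (norm x)\<^sup>2 / 2\<close> has modulus 1.
  For this normalisation the step-size range of the regret bound has to be open at
  \<open>2 * \<sigma> / L\<close>: for \<open>\<omega> z = \<sigma> / 2 * (norm z)\<^sup>2\<close>, \<open>g z = L / 2 * (norm z)\<^sup>2\<close> and \<open>h = 0\<close> the error-free
  step of that size is the reflection \<open>x \<mapsto> -x\<close>, whose regret grows linearly in the horizon.\<close>

definition strongly_convex :: "real \<Rightarrow> ('a::real_inner \<Rightarrow> real) \<Rightarrow> bool" where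
  "strongly_convex \<sigma> f \<longleftrightarrow>
     (\<forall>x y. \<forall>t\<in>{0..1}.
        f (t *\<^sub>R x + (1 - t) *\<^sub>R y)
          \<le> t * f x + (1 - t) * f y - \<sigma> / 2 * t * (1 - t) * (norm (x - y))\<^sup>2)"

definition bregman :: "('a::real_inner \<Rightarrow> real) \<Rightarrow> 'a \<Rightarrow> 'a \<Rightarrow> real" where
  "bregman \<omega> x y = \<omega> x - \<omega> y - grad \<omega> y \<bullet> (x - y)"

text \<open>
  The summands \<open>g\<close> are finite on the whole space and differentiable, hence continuous, so they
  are automatically proper and closed.
\<close>

definition composite_losses ::
    "nat \<Rightarrow> (nat \<Rightarrow> 'a::real_inner \<Rightarrow> real) \<Rightarrow> (nat \<Rightarrow> 'a \<Rightarrow> real)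
      \<Rightarrow> (nat \<Rightarrow> real) \<Rightarrow> (nat \<Rightarrow> real) \<Rightarrow> bool" where
  "composite_losses T g h Lk Bk \<longleftrightarrow>
     (\<forall>k\<in>{1..T}. convex_on UNIV (g k) \<and> lipschitz_gradient (Lk k) (g k)
               \<and> convex_on UNIV (h k) \<and> (Bk k)-lipschitz_on UNIV (h k))"

text \<open>
  \<open>y k\<close> is the exact proximal mirror step computed from \<open>x (k - 1)\<close> with gradient error \<open>e k\<close>;
  the iterate \<open>x k\<close> is any feasible point within \<open>\<epsilon> k\<close> of it.
\<close>

definition inexact_online_pmd ::
    "'a::real_inner set \<Rightarrow> real \<Rightarrow> ('a \<Rightarrow> real) \<Rightarrow> nat
      \<Rightarrow> (nat \<Rightarrow> 'a \<Rightarrow> real) \<Rightarrow> (nat \<Rightarrow> 'a \<Rightarrow> real)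
      \<Rightarrow> (nat \<Rightarrow> 'a) \<Rightarrow> (nat \<Rightarrow> real) \<Rightarrow> (nat \<Rightarrow> 'a) \<Rightarrow> (nat \<Rightarrow> 'a) \<Rightarrow> bool" where
  "inexact_online_pmd \<Omega> lam \<omega> T g h e \<epsilon> y x \<longleftrightarrow>
     x 0 \<in> \<Omega> \<and>
     (\<forall>k\<in>{1..T}. \<epsilon> k > 0
        \<and> is_arg_min (\<lambda>z. h k z + (grad (g k) (x (k - 1)) + e k) \<bullet> z
                             + (1 / lam) * bregman \<omega> z (x (k - 1))) (\<lambda>z. z \<in> \<Omega>) (y k)
        \<and> x k \<in> \<Omega> \<and> norm (x k - y k) \<le> \<epsilon> k)"

end

theory Submission
  imports Defs
begin

text \<open>
  The potential is the Bregman divergence from the current comparator to the current iterate. Write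
  \<open>d\<^sub>k\<close> for the length of the \<open>k\<close>-th exact proximal step, \<open>r\<^sub>k\<close> for the distance of \<open>x\<^sub>k\<close> to
  \<open>x\<^sub>k\<^sup>*\<close>, and \<open>q\<^sub>k\<close> for the sum of the gradient error, the inexactness \<open>\<epsilon>\<^sub>k\<close> and the movement of
  the comparator, so that the \<open>q\<^sub>k\<close> add up to \<open>Q = E + P + S\<close>.

  The usual mirror descent inequality bounds the regret of a round by the decrease of the
  potential divided by \<open>lam\<close>, plus \<open>(L / 2 - \<sigma> / (2 lam)) d\<^sub>k\<^sup>2\<close>. For step sizes above
  \<open>\<sigma> / L\<close> that last term is positive, so the squared steps have to be summable. The function
  values cannot give this, because the losses change from round to round and their decreases do
  not telescope. It comes from the iterates instead: at the minimiser of a round the gradient of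
  the smooth part is the negative of a subgradient of the other part, and comparing it
  with the gradient at the iterate by co-coercivity shows that the proximal step decreases the
  potential by at least \<open>(\<sigma> / 2 - lam L / 4) d\<^sub>k\<^sup>2\<close>. This amount is positive exactly for
  \<open>lam L < 2 \<sigma>\<close> (\<open>proximal_step.contraction\<close>).

  The errors and the moving comparator raise the potential by at most a multiple of
  \<open>q\<^sub>k (q\<^sub>k + r\<^sub>k\<^sub>-\<^sub>1 + r\<^sub>k)\<close> per round. The potential dominates \<open>r\<^sub>k\<^sup>2\<close> while these increments are
  linear in the distances, so all distances are of the order \<open>1 + Q\<close>, and the increments and the
  squared steps sum to the order \<open>1 + Q\<^sup>2\<close> (\<open>self_bounding_drift\<close>). Summing the one-round regret
  bounds \<open>proximal_step.regret\<close> then gives the claim; the loss between the exact point and the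
  iterate is harmless because the gradient of the smooth part at the minimiser has norm at most
  \<open>B\<close>.
\<close>

section \<open>Gradients of differentiable functions on a Euclidean space\<close>

text \<open>In finite dimension every linear functional is an inner product with a vector, namely the
  adjoint of the functional applied to 1.\<close>

lemma GDERIV_grad:
  fixes f :: "'a::euclidean_space \<Rightarrow> real"
  assumes "f differentiable (at x)"
  shows "GDERIV f x :> grad f x"
proof -
  obtain f' where f': "(f has_derivative f') (at x)"
    using assms unfolding differentiable_def by blast
  have "f' = (\<lambda>v. v \<bullet> adjoint f' 1)"
    using adjoint_works[OF has_derivative_linear[OF f'], of _ 1] by auto
  then have ex: "GDERIV f x :> adjoint f' 1"
    using f' by (simp add: gderiv_def)
  moreover have "D = adjoint f' 1" if "GDERIV f x :> D" for D
  proof -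
    have "(\<lambda>v. v \<bullet> D) = (\<lambda>v. v \<bullet> adjoint f' 1)"
      using that ex has_derivative_unique unfolding gderiv_def by blast
    then show ?thesis by (metis vector_eq_ldot)
  qed
  ultimately show ?thesis
    unfolding grad_def by (rule theI)
qed

lemma GDERIV_along_line:
  fixes f :: "'a::real_inner \<Rightarrow> real"
  assumes "GDERIV f (x + t *\<^sub>R v) :> D"
  shows "((\<lambda>s. f (x + s *\<^sub>R v)) has_real_derivative D \<bullet> v) (at t)"
proof -
  have "(f has_derivative (\<lambda>w. w \<bullet> D)) (at (x + t *\<^sub>R v))"
    using assms by (simp add: gderiv_def)
  moreover have "((\<lambda>s. x + s *\<^sub>R v) has_derivative (\<lambda>s. s *\<^sub>R v)) (at t)"
    by (auto intro!: derivative_eq_intros)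
  ultimately have "((\<lambda>s. f (x + s *\<^sub>R v)) has_derivative (\<lambda>s. (s *\<^sub>R v) \<bullet> D)) (at t)"
    by (rule has_derivative_compose[rotated])
  then show ?thesis
    unfolding has_field_derivative_def
    by (rule has_derivative_eq_rhs) (auto simp: inner_commute)
qed

lemma GDERIV_directional_limit:
  fixes f :: "'a::real_inner \<Rightarrow> real"
  assumes "GDERIV f x :> D"
  shows "((\<lambda>t. (f (x + t *\<^sub>R v) - f x) / t) \<longlongrightarrow> D \<bullet> v) (at_right 0)"
proof -
  have "((\<lambda>s. f (x + s *\<^sub>R v)) has_real_derivative D \<bullet> v) (at 0)"
    by (rule GDERIV_along_line) (use assms in simp)
  then have "((\<lambda>t. (f (x + t *\<^sub>R v) - f x) / t) \<longlongrightarrow> D \<bullet> v) (at 0)"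
    by (simp add: has_field_derivative_iff)
  then show ?thesis
    by (rule tendsto_mono[OF at_le, rotated]) simp
qed

lemma lipschitz_gradient_GDERIV:
  fixes f :: "'a::euclidean_space \<Rightarrow> real"
  assumes "lipschitz_gradient K f"
  shows "GDERIV f x :> grad f x"
  using assms GDERIV_grad unfolding lipschitz_gradient_def by blast

lemma lipschitz_gradient_norm_le:
  assumes "lipschitz_gradient K f"
  shows "norm (grad f x - grad f y) \<le> K * norm (x - y)"
  using assms lipschitz_onD[of K UNIV "grad f" x y]
  unfolding lipschitz_gradient_def dist_norm by auto

lemma lipschitz_gradient_mono:
  assumes "lipschitz_gradient K f" "K \<le> K'"
  shows "lipschitz_gradient K' f"
  using assms lipschitz_on_le unfolding lipschitz_gradient_def by blast

lemma lipschitz_gradient_nonneg: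
  assumes "lipschitz_gradient K f"
  shows "0 \<le> K"
  using assms lipschitz_on_nonneg unfolding lipschitz_gradient_def by blast

lemma inner_le_of_norm_le:
  fixes a b :: "'a::real_inner"
  assumes "norm a \<le> K"
  shows "a \<bullet> b \<le> K * norm b"
  by (meson assms mult_right_mono norm_cauchy_schwarz norm_ge_zero order_trans)

section \<open>Smooth and strongly convex functions\<close>

lemma convex_imp_strongly_convex_0:
  assumes "convex_on UNIV f"
  shows "strongly_convex 0 f"
  using convex_onD[OF assms] unfolding strongly_convex_def
  by (auto simp: add.commute)

text \<open>The defining inequality, divided by \<open>t\<close>, bounds the difference quotient from \<open>y\<close> towards
  \<open>x\<close>; the bound follows for \<open>t\<close> tending to 0.\<close>

lemma strongly_convex_first_order:
  fixes f :: "'a::real_inner \<Rightarrow> real"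
  assumes sc: "strongly_convex \<sigma> f" and D: "GDERIV f y :> D"
  shows "f y + D \<bullet> (x - y) + \<sigma> / 2 * (norm (x - y))\<^sup>2 \<le> f x"
proof -
  let ?N = "(norm (x - y))\<^sup>2"
  have lim1: "((\<lambda>t. (f (y + t *\<^sub>R (x - y)) - f y) / t) \<longlongrightarrow> D \<bullet> (x - y)) (at_right 0)"
    by (rule GDERIV_directional_limit[OF D])
  have lim2: "((\<lambda>t. f x - f y - \<sigma> / 2 * (1 - t) * ?N) \<longlongrightarrow> f x - f y - \<sigma> / 2 * (1 - 0) * ?N) (at_right 0)"
    by (intro tendsto_intros)
  have "\<forall>\<^sub>F t in at_right 0. (0::real) < t \<and> t < 1"
    by (subst eventually_at_right[of 0 1]) (auto intro: exI[of _ 1])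
  then have "\<forall>\<^sub>F t in at_right 0.
      (f (y + t *\<^sub>R (x - y)) - f y) / t \<le> f x - f y - \<sigma> / 2 * (1 - t) * ?N"
  proof (rule eventually_mono)
    fix t :: real assume t: "0 < t \<and> t < 1"
    have "t *\<^sub>R x + (1 - t) *\<^sub>R y = y + t *\<^sub>R (x - y)"
      by (simp add: algebra_simps)
    then have "f (y + t *\<^sub>R (x - y)) \<le> t * f x + (1 - t) * f y - \<sigma> / 2 * t * (1 - t) * ?N"
      using sc t unfolding strongly_convex_def
      by (metis atLeastAtMost_iff less_eq_real_def)
    then have "f (y + t *\<^sub>R (x - y)) - f y \<le> (f x - f y - \<sigma> / 2 * (1 - t) * ?N) * t"
      by (simp add: algebra_simps)
    then show "(f (y + t *\<^sub>R (x - y)) - f y) / t \<le> f x - f y - \<sigma> / 2 * (1 - t) * ?N"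
      using t by (simp add: pos_divide_le_eq)
  qed
  from tendsto_le[OF _ lim2 lim1 this] show ?thesis by simp
qed

lemma convex_first_order:
  fixes f :: "'a::real_inner \<Rightarrow> real"
  assumes "convex_on UNIV f" and "GDERIV f y :> D"
  shows "f y + D \<bullet> (x - y) \<le> f x"
  using strongly_convex_first_order[OF convex_imp_strongly_convex_0] assms by fastforce

text \<open>Along the segment from \<open>x\<close> to \<open>z\<close> the difference of the two sides has non-positive
  derivative, because the gradient drifts by at most \<open>K\<close> times the distance travelled.\<close>

lemma descent_lemma:
  fixes f :: "'a::euclidean_space \<Rightarrow> real"
  assumes lg: "lipschitz_gradient K f"
  shows "f z \<le> f x + grad f x \<bullet> (z - x) + K / 2 * (norm (z - x))\<^sup>2"
proof -
  define v where "v = z - x"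
  define \<phi> where "\<phi> = (\<lambda>t. f (x + t *\<^sub>R v) - t * (grad f x \<bullet> v) - K / 2 * t\<^sup>2 * (norm v)\<^sup>2)"
  have "\<phi> 1 \<le> \<phi> 0"
  proof (rule DERIV_nonpos_imp_nonincreasing[where f = \<phi>])
    fix t :: real assume t: "0 \<le> t" "t \<le> 1"
    have "(\<phi> has_real_derivative
        grad f (x + t *\<^sub>R v) \<bullet> v - grad f x \<bullet> v - K * t * (norm v)\<^sup>2) (at t)"
      unfolding \<phi>_def
      by (rule derivative_eq_intros GDERIV_along_line[OF lipschitz_gradient_GDERIV[OF lg]] refl)+ simp
    moreover have "(grad f (x + t *\<^sub>R v) - grad f x) \<bullet> v \<le> K * norm (t *\<^sub>R v) * norm v"
      using inner_le_of_norm_le lipschitz_gradient_norm_le[OF lg, of "x + t *\<^sub>R v" x] by simp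
    then have "grad f (x + t *\<^sub>R v) \<bullet> v - grad f x \<bullet> v - K * t * (norm v)\<^sup>2 \<le> 0"
      using t by (simp add: inner_diff_left power2_eq_square algebra_simps)
    ultimately show "\<exists>y. DERIV \<phi> t :> y \<and> y \<le> 0" by blast
  qed simp
  then show ?thesis by (simp add: \<phi>_def v_def)
qed

text \<open>The tangent of \<open>f\<close> at \<open>y\<close> lies below the descent-lemma parabola of \<open>f\<close> at \<open>x\<close>; the
  remainder is what this comparison gives at the point where the gap between the two is
  smallest.\<close>

lemma convex_smooth_gap:
  fixes f :: "'a::euclidean_space \<Rightarrow> real"
  assumes "convex_on UNIV f" and lg: "lipschitz_gradient K f" and "0 < K"
  shows "f y + grad f y \<bullet> (x - y) + (norm (grad f x - grad f y))\<^sup>2 / (2 * K) \<le> f x"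
proof -
  define d where "d = grad f x - grad f y"
  \<comment> \<open>A gradient step of length \<open>1 / K\<close> from \<open>x\<close> for the tilted function \<open>f - grad f y \<bullet> _\<close>,
      which is minimal at \<open>y\<close>.\<close>
  define w where "w = x - (1 / K) *\<^sub>R d"
  have "f y + grad f y \<bullet> (w - y) \<le> f w"
    by (rule convex_first_order[OF assms(1) lipschitz_gradient_GDERIV[OF lg]])
  also have "f w \<le> f x + grad f x \<bullet> (w - x) + K / 2 * (norm (w - x))\<^sup>2"
    by (rule descent_lemma[OF lg])
  finally have "f y + grad f y \<bullet> (x - y) - (1 / K) * (grad f y \<bullet> d)
      \<le> f x - (1 / K) * (grad f x \<bullet> d) + K / 2 * (norm ((1 / K) *\<^sub>R d))\<^sup>2"
    by (simp add: w_def inner_diff_right)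
  moreover have "K / 2 * (norm ((1 / K) *\<^sub>R d))\<^sup>2 = (norm d)\<^sup>2 / (2 * K)"
    using \<open>0 < K\<close> by (simp add: power2_eq_square)
  moreover have "(1 / K) * (grad f x \<bullet> d) - (1 / K) * (grad f y \<bullet> d) = 2 * ((norm d)\<^sup>2 / (2 * K))"
    using \<open>0 < K\<close> by (simp add: d_def power2_norm_eq_inner inner_diff_left diff_divide_distrib)
  ultimately show ?thesis by (simp add: d_def)
qed

lemma gradient_cocoercive:
  fixes f :: "'a::euclidean_space \<Rightarrow> real"
  assumes "convex_on UNIV f" and "lipschitz_gradient K f" and "0 < K"
  shows "(norm (grad f x - grad f y))\<^sup>2 / K \<le> (grad f x - grad f y) \<bullet> (x - y)"
  using convex_smooth_gap[OF assms, of y x] convex_smooth_gap[OF assms, of x y]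
  by (simp add: inner_diff_left inner_diff_right norm_minus_commute)

text \<open>Co-coercivity controls the inner product at \<open>x\<close>; moving the test point from \<open>x\<close> to
  \<open>y\<close> costs at most \<open>norm d * norm (y - x)\<close>, and completing the square in \<open>norm d\<close>, the norm of
  the gradient difference, leaves the constant \<open>K / 4\<close>.\<close>

lemma gradient_cocoercive_shifted:
  fixes f :: "'a::euclidean_space \<Rightarrow> real"
  assumes "convex_on UNIV f" and "lipschitz_gradient K f" and "0 < K"
  shows "- (K / 4 * (norm (y - x))\<^sup>2) \<le> (grad f x - grad f u) \<bullet> (y - u)"
proof -
  define d where "d = grad f x - grad f u"
  have "(norm d)\<^sup>2 / K \<le> d \<bullet> (x - u)"
    unfolding d_def by (rule gradient_cocoercive[OF assms])
  moreover have "- (d \<bullet> (y - x)) \<le> norm d * norm (y - x)"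
    using Cauchy_Schwarz_ineq2[of d "y - x"] by linarith
  moreover have "norm d * norm (y - x) \<le> (norm d)\<^sup>2 / K + K / 4 * (norm (y - x))\<^sup>2"
  proof -
    have "0 \<le> (norm d - K / 2 * norm (y - x))\<^sup>2 / K" using \<open>0 < K\<close> by simp
    also have "\<dots> = (norm d)\<^sup>2 / K + K / 4 * (norm (y - x))\<^sup>2 - norm d * norm (y - x)"
      using \<open>0 < K\<close> by (simp add: power2_diff power_mult_distrib field_simps power2_eq_square)
    finally show ?thesis by simp
  qed
  moreover have "d \<bullet> (y - u) = d \<bullet> (y - x) + d \<bullet> (x - u)"
    by (simp add: inner_diff_right)
  ultimately show ?thesis unfolding d_def by linarith
qed

section \<open>First-order optimality for a convex plus a differentiable function\<close>

text \<open>Compare \<open>y\<close> with a point \<open>y + t (z - y)\<close>: convexity bounds the change of \<open>h\<close> by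
  \<open>t (h z - h y)\<close>; divide by \<open>t\<close> and let it tend to 0.\<close>

lemma argmin_variational_inequality:
  fixes h \<phi> :: "'a::real_inner \<Rightarrow> real"
  assumes h: "convex_on UNIV h" and p: "GDERIV \<phi> y :> p"
    and min: "\<And>z. h y + \<phi> y \<le> h z + \<phi> z"
  shows "h y - h z \<le> p \<bullet> (z - y)"
proof -
  have lim: "((\<lambda>t. (\<phi> (y + t *\<^sub>R (z - y)) - \<phi> y) / t) \<longlongrightarrow> p \<bullet> (z - y)) (at_right 0)"
    by (rule GDERIV_directional_limit[OF p])
  have "\<forall>\<^sub>F t in at_right 0. (0::real) < t \<and> t < 1"
    by (subst eventually_at_right[of 0 1]) (auto intro: exI[of _ 1])
  then have "\<forall>\<^sub>F t in at_right 0. h y - h z \<le> (\<phi> (y + t *\<^sub>R (z - y)) - \<phi> y) / t"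
  proof (rule eventually_mono)
    fix t :: real assume t: "0 < t \<and> t < 1"
    have "h ((1 - t) *\<^sub>R y + t *\<^sub>R z) \<le> (1 - t) * h y + t * h z"
      using t by (intro convex_onD[OF h]) auto
    moreover have "(1 - t) *\<^sub>R y + t *\<^sub>R z = y + t *\<^sub>R (z - y)"
      by (simp add: algebra_simps)
    ultimately have "(h y - h z) * t \<le> \<phi> (y + t *\<^sub>R (z - y)) - \<phi> y"
      using min[of "y + t *\<^sub>R (z - y)"] by (simp add: algebra_simps)
    then show "h y - h z \<le> (\<phi> (y + t *\<^sub>R (z - y)) - \<phi> y) / t"
      using t by (simp add: pos_le_divide_eq)
  qed
  from tendsto_le[OF _ lim tendsto_const this] show ?thesis by simp
qed

section \<open>Bregman divergences\<close>

lemma bregman_three_point: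
  "bregman \<omega> u x - bregman \<omega> u y - bregman \<omega> y x = (grad \<omega> y - grad \<omega> x) \<bullet> (u - y)"
  unfolding bregman_def by (simp add: inner_diff_left inner_diff_right)

lemma bregman_ge:
  fixes \<omega> :: "'a::euclidean_space \<Rightarrow> real"
  assumes "strongly_convex \<sigma> \<omega>" "lipschitz_gradient G \<omega>"
  shows "\<sigma> / 2 * (norm (x - y))\<^sup>2 \<le> bregman \<omega> x y"
  using strongly_convex_first_order[OF assms(1) lipschitz_gradient_GDERIV[OF assms(2)], of y x]
  unfolding bregman_def by linarith

lemma bregman_le:
  fixes \<omega> :: "'a::euclidean_space \<Rightarrow> real"
  assumes "lipschitz_gradient G \<omega>"
  shows "bregman \<omega> x y \<le> G / 2 * (norm (x - y))\<^sup>2"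
  using descent_lemma[OF assms, of x y] unfolding bregman_def by linarith

text \<open>A Bregman divergence has no triangle inequality. The next two bounds replace it: they say
  what moving the comparator, or the reference point, costs.\<close>

lemma bregman_move_left:
  fixes \<omega> :: "'a::euclidean_space \<Rightarrow> real"
  assumes "lipschitz_gradient G \<omega>"
  shows "bregman \<omega> u x \<le> bregman \<omega> u0 x + G / 2 * (norm (u - u0))\<^sup>2
           + G * norm (x - u0) * norm (u - u0)"
proof -
  have "bregman \<omega> u x = bregman \<omega> u0 x + bregman \<omega> u u0 + (grad \<omega> u0 - grad \<omega> x) \<bullet> (u - u0)"
    using bregman_three_point[of \<omega> u x u0] by linarith
  moreover have "(grad \<omega> u0 - grad \<omega> x) \<bullet> (u - u0) \<le> G * norm (x - u0) * norm (u - u0)"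
    using inner_le_of_norm_le lipschitz_gradient_norm_le[OF assms, of u0 x]
    by (metis norm_minus_commute)
  ultimately show ?thesis using bregman_le[OF assms, of u u0] by linarith
qed

lemma bregman_move_right:
  fixes \<omega> :: "'a::euclidean_space \<Rightarrow> real"
  assumes "strongly_convex \<sigma> \<omega>" "0 \<le> \<sigma>" "lipschitz_gradient G \<omega>"
  shows "bregman \<omega> u x \<le> bregman \<omega> u y + G * norm (x - y) * norm (x - u)"
proof -
  have "bregman \<omega> u x + bregman \<omega> x y = bregman \<omega> u y + (grad \<omega> x - grad \<omega> y) \<bullet> (x - u)"
    using bregman_three_point[of \<omega> u y x] by (simp add: inner_diff_right)
  moreover have "0 \<le> bregman \<omega> x y"
    using bregman_ge[OF assms(1,3), of x y] \<open>0 \<le> \<sigma>\<close>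
    by (meson half_gt_zero_iff less_eq_real_def mult_nonneg_nonneg order_trans zero_le_power2
        divide_nonneg_pos zero_less_numeral)
  moreover have "(grad \<omega> x - grad \<omega> y) \<bullet> (x - u) \<le> G * norm (x - y) * norm (x - u)"
    using inner_le_of_norm_le lipschitz_gradient_norm_le[OF assms(3)] by blast
  ultimately show ?thesis by linarith
qed

section \<open>One step of the algorithm\<close>

text \<open>In one round the iterate \<open>x\<close> is mapped to \<open>x'\<close> through the exact proximal point \<open>y\<close>, while
  the comparator moves from \<open>u0\<close> to the minimiser \<open>u\<close> of the current loss.\<close>

locale proximal_step =
  fixes g h \<omega> :: "'a::euclidean_space \<Rightarrow> real"
    and L B G \<sigma> lam \<epsilon> :: real
    and e x y x' u u0 :: 'a
  assumes g_convex: "convex_on UNIV g" and g_smooth: "lipschitz_gradient L g"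
    and h_convex: "convex_on UNIV h" and h_lipschitz: "B-lipschitz_on UNIV h"
    and \<omega>_convex: "strongly_convex \<sigma> \<omega>" and \<omega>_smooth: "lipschitz_gradient G \<omega>"
    and L_pos: "0 < L" and \<sigma>_pos: "0 < \<sigma>" and lam_pos: "0 < lam"
    and y_min: "\<And>z. h y + ((grad g x + e) \<bullet> y + (1 / lam) * bregman \<omega> y x)
                     \<le> h z + ((grad g x + e) \<bullet> z + (1 / lam) * bregman \<omega> z x)"
    and u_min: "\<And>z. h u + g u \<le> h z + g z"
    and x'_near: "norm (x' - y) \<le> \<epsilon>"
begin

definition perturbation :: real where
  "perturbation = norm e + \<epsilon> + norm (u - u0)"

text \<open>The increase of the potential is bilinear in the perturbation and the distances of the
  iterates to their comparators; this is the common bound for all its parts.\<close>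

definition error_term :: real where
  "error_term = perturbation * (perturbation + norm (x - u0) + norm (x' - u))"

lemma eps_nonneg: "0 \<le> \<epsilon>"
  using x'_near norm_ge_zero order_trans by blast

lemma G_nonneg: "0 \<le> G"
  by (rule lipschitz_gradient_nonneg[OF \<omega>_smooth])

lemma B_nonneg: "0 \<le> B"
  by (rule lipschitz_on_nonneg[OF h_lipschitz])

lemma y_near_u: "norm (y - u) \<le> norm (x' - u) + \<epsilon>"
  using norm_triangle_ineq[of "y - x'" "x' - u"] x'_near by (simp add: norm_minus_commute)

text \<open>The objective of the proximal step is \<open>h\<close> plus a function with gradient
  \<open>grad g x + e + (grad \<omega> y - grad \<omega> x) / lam\<close> at \<open>y\<close>; the three-point identity turns its
  last summand into divergences.\<close>

lemma prox_optimality: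
  "h y - h z \<le> (grad g x + e) \<bullet> (z - y)
     + (1 / lam) * (bregman \<omega> z x - bregman \<omega> z y - bregman \<omega> y x)"
proof -
  let ?\<phi> = "\<lambda>z. (grad g x + e) \<bullet> z + (1 / lam) * bregman \<omega> z x"
  have d: "(\<omega> has_derivative (\<lambda>v. v \<bullet> grad \<omega> y)) (at y)"
    using lipschitz_gradient_GDERIV[OF \<omega>_smooth] by (simp add: gderiv_def)
  have "GDERIV ?\<phi> y :> grad g x + e + (1 / lam) *\<^sub>R (grad \<omega> y - grad \<omega> x)"
    unfolding gderiv_def bregman_def
    apply (rule derivative_eq_intros d refl)+
    by (auto simp: algebra_simps inner_commute inner_diff_left inner_diff_right)
  then have "h y - h z \<le> (grad g x + e + (1 / lam) *\<^sub>R (grad \<omega> y - grad \<omega> x)) \<bullet> (z - y)"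
    by (rule argmin_variational_inequality[OF h_convex]) (rule y_min)
  then show ?thesis
    unfolding bregman_three_point by (simp add: inner_add_left)
qed

lemma comparator_optimality: "h u - h z \<le> grad g u \<bullet> (z - u)"
  by (rule argmin_variational_inequality[OF h_convex lipschitz_gradient_GDERIV[OF g_smooth]])
    (rule u_min)

text \<open>By optimality the gradient of \<open>g\<close> at \<open>u\<close> is the negative of a subgradient of the
  \<open>B\<close>-Lipschitz function \<open>h\<close>; testing with the point \<open>u - grad g u\<close> extracts its norm.\<close>

lemma comparator_gradient_bound: "norm (grad g u) \<le> B"
proof -
  have "grad g u \<bullet> grad g u \<le> h (u - grad g u) - h u"
    using comparator_optimality[of "u - grad g u"] by simp
  also have "\<dots> \<le> B * norm (grad g u)"
    using lipschitz_onD[OF h_lipschitz, of "u - grad g u" u] by (simp add: dist_norm)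
  finally have "norm (grad g u) * norm (grad g u) \<le> B * norm (grad g u)"
    by (simp add: norm_eq_sqrt_inner)
  then show ?thesis using B_nonneg
    by (cases "grad g u = 0") auto
qed

lemma gradient_error_bound: "e \<bullet> (u - y) \<le> error_term"
proof -
  have "e \<bullet> (u - y) \<le> norm e * norm (y - u)"
    using norm_cauchy_schwarz[of e "u - y"] by (simp add: norm_minus_commute)
  also have "\<dots> \<le> perturbation * (perturbation + norm (x - u0) + norm (x' - u))"
  proof (rule mult_mono)
    show "norm e \<le> perturbation" "0 \<le> perturbation"
      using eps_nonneg by (auto simp: perturbation_def)
    show "norm (y - u) \<le> perturbation + norm (x - u0) + norm (x' - u)"
      using y_near_u norm_ge_zero[of e] norm_ge_zero[of "u - u0"] norm_ge_zero[of "x - u0"]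
      unfolding perturbation_def by linarith
  qed simp
  finally show ?thesis by (simp add: error_term_def)
qed

text \<open>This passes from the quantities of the exact step to the potential before and after the
  round: replacing \<open>u\<close> by \<open>u0\<close> and \<open>y\<close> by \<open>x'\<close> is paid for by the error term.\<close>

lemma bregman_drift:
  "bregman \<omega> u x - bregman \<omega> u y \<le> bregman \<omega> u0 x - bregman \<omega> u x' + G * error_term"
proof -
  have "bregman \<omega> u x' \<le> bregman \<omega> u y + G * norm (x' - y) * norm (x' - u)"
    by (rule bregman_move_right[OF \<omega>_convex _ \<omega>_smooth]) (use \<sigma>_pos in simp)
  moreover have "bregman \<omega> u x \<le> bregman \<omega> u0 x + G / 2 * (norm (u - u0))\<^sup>2
           + G * norm (x - u0) * norm (u - u0)"
    by (rule bregman_move_left[OF \<omega>_smooth])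
  moreover have "norm (x' - y) * norm (x' - u) + (norm (u - u0))\<^sup>2 / 2 + norm (x - u0) * norm (u - u0)
      \<le> error_term"
  proof -
    have "norm (x' - y) * norm (x' - u) \<le> perturbation * norm (x' - u)"
      using x'_near by (intro mult_right_mono) (auto simp: perturbation_def add_increasing add_increasing2)
    moreover have "norm (x - u0) * norm (u - u0) \<le> perturbation * norm (x - u0)"
      using eps_nonneg by (subst mult.commute, intro mult_right_mono) (auto simp: perturbation_def)
    moreover have "(norm (u - u0))\<^sup>2 \<le> perturbation\<^sup>2"
      using eps_nonneg by (intro power_mono) (auto simp: perturbation_def)
    then have "(norm (u - u0))\<^sup>2 / 2 \<le> perturbation\<^sup>2"
      using zero_le_power2[of "norm (u - u0)"] by linarith
    ultimately show ?thesis
      unfolding error_term_def by (simp add: algebra_simps power2_eq_square)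
  qed
  from mult_left_mono[OF this G_nonneg]
  have "G * norm (x' - y) * norm (x' - u) + G / 2 * (norm (u - u0))\<^sup>2
      + G * norm (x - u0) * norm (u - u0) \<le> G * error_term"
    by (simp add: algebra_simps)
  ultimately show ?thesis by linarith
qed

text \<open>The variational inequalities of \<open>y\<close> (tested at \<open>u\<close>) and of \<open>u\<close> (tested at \<open>y\<close>) are
  added, so that \<open>h\<close> cancels and only the gradient difference of \<open>g\<close> remains. Shifted
  co-coercivity costs \<open>lam L / 4\<close>, strong convexity gains \<open>\<sigma> / 2\<close>.\<close>

lemma contraction:
  "bregman \<omega> u x' + (\<sigma> / 2 - lam * L / 4) * (norm (y - x))\<^sup>2
     \<le> bregman \<omega> u0 x + (G + lam) * error_term"
proof -
  have a: "h y - h u \<le> (grad g x + e) \<bullet> (u - y)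
     + (1 / lam) * (bregman \<omega> u x - bregman \<omega> u y - bregman \<omega> y x)"
    by (rule prox_optimality)
  have b: "h u - h y \<le> grad g u \<bullet> (y - u)"
    by (rule comparator_optimality)
  have c: "- (L / 4 * (norm (y - x))\<^sup>2) \<le> (grad g x - grad g u) \<bullet> (y - u)"
    by (rule gradient_cocoercive_shifted[OF g_convex g_smooth L_pos])
  have "0 \<le> L / 4 * (norm (y - x))\<^sup>2 + error_term
      + (1 / lam) * (bregman \<omega> u x - bregman \<omega> u y - bregman \<omega> y x)"
    using a b c gradient_error_bound
    by (simp add: inner_diff_left inner_diff_right inner_add_left)
  from mult_left_mono[OF this, of lam] lam_pos
  have "0 \<le> lam * L / 4 * (norm (y - x))\<^sup>2 + lam * error_term
      + (bregman \<omega> u x - bregman \<omega> u y - bregman \<omega> y x)"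
    by (simp add: algebra_simps)
  then show ?thesis
    using bregman_drift bregman_ge[OF \<omega>_convex \<omega>_smooth, of y x]
    by (simp add: algebra_simps)
qed

lemma regret_exact_point:
  "(g y + h y) - (g u + h u)
     \<le> (bregman \<omega> u0 x - bregman \<omega> u x') / lam + L / 2 * (norm (y - x))\<^sup>2
       + (G / lam + 1) * error_term"
proof -
  have "g y \<le> g x + grad g x \<bullet> (y - x) + L / 2 * (norm (y - x))\<^sup>2"
    by (rule descent_lemma[OF g_smooth])
  moreover have "g x + grad g x \<bullet> (u - x) \<le> g u"
    by (rule convex_first_order[OF g_convex lipschitz_gradient_GDERIV[OF g_smooth]])
  moreover have "h y - h u \<le> (grad g x + e) \<bullet> (u - y)
     + (1 / lam) * (bregman \<omega> u x - bregman \<omega> u y - bregman \<omega> y x)"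
    by (rule prox_optimality)
  ultimately have "(g y + h y) - (g u + h u) \<le> L / 2 * (norm (y - x))\<^sup>2 + error_term
      + (1 / lam) * (bregman \<omega> u x - bregman \<omega> u y - bregman \<omega> y x)"
    using gradient_error_bound by (simp add: inner_diff_right inner_add_left)
  also have "bregman \<omega> u x - bregman \<omega> u y - bregman \<omega> y x
      \<le> bregman \<omega> u0 x - bregman \<omega> u x' + G * error_term"
  proof -
    have "0 \<le> \<sigma> / 2 * (norm (y - x))\<^sup>2" using \<sigma>_pos by simp
    then show ?thesis
      using bregman_drift bregman_ge[OF \<omega>_convex \<omega>_smooth, of y x] by linarith
  qed
  finally show ?thesis
    using lam_pos by (simp add: divide_right_mono mult_left_mono algebra_simps add_divide_distrib diff_divide_distrib)
qed

text \<open>The gradient of \<open>g\<close> has no global bound, but at \<open>x'\<close> it exceeds \<open>B\<close> by at most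
  \<open>L\<close> times the distance to \<open>u\<close>, which the error term absorbs.\<close>

lemma inexactness_cost:
  "(g x' + h x') - (g y + h y) \<le> L * error_term + 2 * B * perturbation"
proof -
  have "g x' + grad g x' \<bullet> (y - x') \<le> g y"
    by (rule convex_first_order[OF g_convex lipschitz_gradient_GDERIV[OF g_smooth]])
  then have "g x' - g y \<le> grad g x' \<bullet> (x' - y)"
    by (simp add: inner_diff_right)
  also have "\<dots> \<le> (B + L * norm (x' - u)) * norm (x' - y)"
  proof (rule inner_le_of_norm_le)
    show "norm (grad g x') \<le> B + L * norm (x' - u)"
      using norm_triangle_ineq[of "grad g u" "grad g x' - grad g u"]
        comparator_gradient_bound lipschitz_gradient_norm_le[OF g_smooth, of x' u] by simp
  qed
  finally have g: "g x' - g y \<le> B * norm (x' - y) + L * (norm (x' - y) * norm (x' - u))"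
    by (simp add: algebra_simps)
  have h: "h x' - h y \<le> B * norm (x' - y)"
    using lipschitz_onD[OF h_lipschitz, of x' y] by (simp add: dist_norm)
  have q: "norm (x' - y) \<le> perturbation"
    using x'_near by (simp add: perturbation_def add_increasing add_increasing2)
  have "0 \<le> perturbation"
    using q norm_ge_zero order_trans by blast
  then have "norm (x' - y) * norm (x' - u) \<le> error_term"
    unfolding error_term_def using q by (intro mult_mono) auto
  then have "L * (norm (x' - y) * norm (x' - u)) \<le> L * error_term"
    using L_pos by (intro mult_left_mono) auto
  moreover have "B * norm (x' - y) \<le> B * perturbation"
    using q B_nonneg by (rule mult_left_mono)
  ultimately show ?thesis using g h by linarith
qed

lemma regret:
  "(g x' + h x') - (g u + h u)
     \<le> (bregman \<omega> u0 x - bregman \<omega> u x') / lam + L / 2 * (norm (y - x))\<^sup>2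
       + (G / lam + 1 + L) * error_term + 2 * B * perturbation"
  using regret_exact_point inexactness_cost by (simp add: algebra_simps)

end

section \<open>Summation over the rounds\<close>

text \<open>The potential \<open>a\<close> dominates \<open>r\<^sup>2\<close>, whereas its increments are only linear in \<open>r\<close>.
  Hence the largest value \<open>M\<close> of \<open>r\<close> satisfies a quadratic inequality
  \<open>\<alpha> M\<^sup>2 \<le> A + K Q (Q + 2 M)\<close>, which forces \<open>M\<close> to be of the order \<open>1 + Q\<close>.\<close>

lemma self_bounding_drift:
  fixes a r d q :: "nat \<Rightarrow> real" and A K c \<alpha> :: real
  defines "w \<equiv> \<lambda>k. q k * (q k + r (k - 1) + r k)"
  assumes step: "\<And>k. k \<in> {1..T} \<Longrightarrow> a k + c * d k \<le> a (k - 1) + K * w k"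
    and lower: "\<And>k. k \<le> T \<Longrightarrow> \<alpha> * (r k)\<^sup>2 \<le> a k"
    and init: "a 0 \<le> A"
    and d_nonneg: "\<And>k. 0 \<le> d k" and r_nonneg: "\<And>k. 0 \<le> r k"
    and q_nonneg: "\<And>k. k \<in> {1..T} \<Longrightarrow> 0 \<le> q k"
    and coeffs: "0 < \<alpha>" "0 \<le> K" "0 \<le> c"
  shows "(\<Sum>k=1..T. w k) \<le> (2 + 2 * (A + K + 2 * K\<^sup>2 / \<alpha>) / \<alpha>) * (1 + (\<Sum>k=1..T. q k)\<^sup>2)"
    and "c * (\<Sum>k=1..T. d k) \<le> A + K * (\<Sum>k=1..T. w k)"
proof -
  define Q where "Q = (\<Sum>k=1..T. q k)"
  define W where "W = (\<Sum>k=1..T. w k)"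
  define M where "M = Max (r ` {..T})"
  have w_nonneg: "0 \<le> w k" if "k \<in> {1..T}" for k
    unfolding w_def using q_nonneg[OF that] r_nonneg by simp
  have telescoped: "a m + c * (\<Sum>k=1..m. d k) \<le> a 0 + K * (\<Sum>k=1..m. w k)" if "m \<le> T" for m
    using that
  proof (induction m)
    case (Suc m)
    then show ?case using step[of "Suc m"] by (simp add: algebra_simps)
  qed simp
  have a_nonneg: "0 \<le> a k" if "k \<le> T" for k
  proof -
    have "0 \<le> \<alpha> * (r k)\<^sup>2" using coeffs by simp
    then show ?thesis using lower[OF that] by linarith
  qed
  show "c * (\<Sum>k=1..T. d k) \<le> A + K * (\<Sum>k=1..T. w k)"
    using telescoped[of T] a_nonneg[of T] init by simp
  have a_le: "a m \<le> A + K * W" if "m \<le> T" for m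
  proof -
    have "(\<Sum>k=1..m. w k) \<le> W"
      unfolding W_def using that w_nonneg by (intro sum_mono2) auto
    then have "K * (\<Sum>k=1..m. w k) \<le> K * W"
      using coeffs by (intro mult_left_mono) auto
    moreover have "0 \<le> c * (\<Sum>k=1..m. d k)"
      using coeffs d_nonneg by (simp add: sum_nonneg)
    ultimately show ?thesis using telescoped[OF that] init by linarith
  qed
  have "M \<in> r ` {..T}" unfolding M_def by (intro Max_in) auto
  then obtain j where j: "j \<le> T" "M = r j" by auto
  have M_nonneg: "0 \<le> M" using j r_nonneg by simp
  have r_le: "r k \<le> M" if "k \<le> T" for k
    unfolding M_def using that by (intro Max_ge) auto
  have q_le: "q k \<le> Q" if "k \<in> {1..T}" for k
    unfolding Q_def using that q_nonneg by (intro member_le_sum) auto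
  have Q_nonneg: "0 \<le> Q" unfolding Q_def using q_nonneg by (intro sum_nonneg)
  have "w k \<le> q k * (Q + 2 * M)" if "k \<in> {1..T}" for k
  proof -
    have "q k + r (k - 1) + r k \<le> Q + 2 * M"
      using q_le[OF that] r_le[of k] r_le[of "k - 1"] that by (simp add: le_diff_conv)
    then show ?thesis unfolding w_def using q_nonneg[OF that] by (rule mult_left_mono)
  qed
  then have "W \<le> (\<Sum>k=1..T. q k * (Q + 2 * M))"
    unfolding W_def by (rule sum_mono)
  then have W_le: "W \<le> Q * (Q + 2 * M)"
    by (simp add: Q_def sum_distrib_right)
  have A_nonneg: "0 \<le> A" using a_nonneg[of 0] init by simp
  have "\<alpha> * M\<^sup>2 \<le> A + K * W"
    using lower[OF j(1)] a_le[OF j(1)] j(2) by simp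
  also have "K * W \<le> K * (Q * (Q + 2 * M))"
    using W_le coeffs by (intro mult_left_mono) auto
  finally have quadratic: "\<alpha> * M\<^sup>2 \<le> A + K * Q\<^sup>2 + 2 * K * Q * M"
    by (simp add: algebra_simps power2_eq_square)
  have "0 \<le> (\<alpha> * M - 2 * K * Q)\<^sup>2 / (2 * \<alpha>)" using coeffs by simp
  also have "\<dots> = \<alpha> * M\<^sup>2 / 2 + 2 * K\<^sup>2 / \<alpha> * Q\<^sup>2 - 2 * K * Q * M"
    using coeffs by (simp add: power2_diff power_mult_distrib field_simps power2_eq_square)
  finally have "\<alpha> * M\<^sup>2 / 2 \<le> A + (K + 2 * K\<^sup>2 / \<alpha>) * Q\<^sup>2"
    using quadratic by (simp add: algebra_simps)
  also have "\<dots> \<le> (A + K + 2 * K\<^sup>2 / \<alpha>) * (1 + Q\<^sup>2)"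
  proof -
    have "0 \<le> A * Q\<^sup>2" "0 \<le> K + 2 * K\<^sup>2 / \<alpha>" using coeffs A_nonneg by auto
    then show ?thesis by (simp only: distrib_left distrib_right mult_1_right add.assoc)
  qed
  finally have M2: "M\<^sup>2 \<le> 2 * (A + K + 2 * K\<^sup>2 / \<alpha>) / \<alpha> * (1 + Q\<^sup>2)"
    using coeffs by (simp add: field_simps)
  have "2 * Q * M \<le> Q\<^sup>2 + M\<^sup>2"
    using zero_le_power2[of "Q - M"] by (simp add: power2_diff)
  then have "W \<le> 2 * Q\<^sup>2 + M\<^sup>2"
    using W_le by (simp add: algebra_simps power2_eq_square)
  then have "W \<le> 2 * (1 + Q\<^sup>2) + M\<^sup>2" by simp
  also have "\<dots> \<le> 2 * (1 + Q\<^sup>2) + 2 * (A + K + 2 * K\<^sup>2 / \<alpha>) / \<alpha> * (1 + Q\<^sup>2)"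
    using M2 by (rule add_left_mono)
  finally show "(\<Sum>k=1..T. w k) \<le> (2 + 2 * (A + K + 2 * K\<^sup>2 / \<alpha>) / \<alpha>) * (1 + (\<Sum>k=1..T. q k)\<^sup>2)"
    by (simp add: W_def Q_def distrib_right)
qed

lemma sum_telescope_pred:
  fixes a :: "nat \<Rightarrow> real"
  shows "(\<Sum>k=1..m. a (k - 1) - a k) = a 0 - a m"
  by (induction m) auto

text \<open>\<open>A\<close> bounds the initial potential and \<open>c\<close> is its decrease per squared proximal step.
  Relative to \<open>1 + Q\<^sup>2\<close>, where \<open>Q\<close> is the total perturbation, \<open>Z\<close> bounds the sum of the error
  terms and \<open>(A + K * Z) / c\<close> the sum of the squared steps.\<close>

definition regret_constant :: "real \<Rightarrow> real \<Rightarrow> real \<Rightarrow> real \<Rightarrow> real \<Rightarrow> real \<Rightarrow> real" where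
  "regret_constant lam L B \<sigma> G D =
     (let A = G / 2 * D\<^sup>2; K = G + lam; c = \<sigma> / 2 - lam * L / 4;
          Z = 2 + 2 * (A + K + 2 * K\<^sup>2 / (\<sigma> / 2)) / (\<sigma> / 2)
      in A / lam + L / 2 * ((A + K * Z) / c) + (G / lam + 1 + L) * Z + 2 * B)"

text \<open>The regret of a round has a telescoping part, a multiple of the squared proximal step, a
  multiple of the error term and a linear term in the perturbation; \<open>self_bounding_drift\<close>
  controls the second and third sum, and \<open>Q \<le> 1 + Q\<^sup>2\<close> the last.\<close>

lemma dynamic_regret_bound:
  fixes g h :: "nat \<Rightarrow> 'a::euclidean_space \<Rightarrow> real"
    and e x y xstar :: "nat \<Rightarrow> 'a" and \<epsilon> :: "nat \<Rightarrow> real"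
  defines "q \<equiv> \<lambda>k. norm (e k) + \<epsilon> k + norm (xstar k - xstar (k - 1))"
  assumes "1 \<le> T"
    and losses: "composite_losses T g h Lk Bk"
    and Lk: "\<And>k. k \<in> {1..T} \<Longrightarrow> Lk k \<le> L" and Bk: "\<And>k. k \<in> {1..T} \<Longrightarrow> Bk k \<le> B"
    and \<omega>: "strongly_convex \<sigma> \<omega>" "lipschitz_gradient G \<omega>"
    and alg: "inexact_online_pmd UNIV lam \<omega> T g h e \<epsilon> y x"
    and opt: "\<And>k. k \<in> {1..T} \<Longrightarrow> is_arg_min (\<lambda>z. g k z + h k z) (\<lambda>z. z \<in> UNIV) (xstar k)"
    and init: "norm (x 0 - xstar 0) \<le> D"
    and pos: "0 < \<sigma>" "0 < lam" "0 < L" and stepsize: "lam * L < 2 * \<sigma>"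
  shows "(\<Sum>k=1..T. (g k (x k) + h k (x k)) - (g k (xstar k) + h k (xstar k)))
           \<le> regret_constant lam L B \<sigma> G D * (1 + (\<Sum>k=1..T. q k)\<^sup>2)"
proof -
  define A where "A = G / 2 * D\<^sup>2"
  define K where "K = G + lam"
  define c where "c = \<sigma> / 2 - lam * L / 4"
  define Z where "Z = 2 + 2 * (A + K + 2 * K\<^sup>2 / (\<sigma> / 2)) / (\<sigma> / 2)"
  define a where "a = (\<lambda>k. bregman \<omega> (xstar k) (x k))"
  define r where "r = (\<lambda>k. norm (x k - xstar k))"
  define d where "d = (\<lambda>k. (norm (y k - x (k - 1)))\<^sup>2)"
  define w where "w = (\<lambda>k. q k * (q k + r (k - 1) + r k))"
  define Q where "Q = (\<Sum>k=1..T. q k)"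
  have round: "proximal_step (g k) (h k) \<omega> L B G \<sigma> lam (\<epsilon> k) (e k) (x (k - 1)) (y k) (x k) (xstar k)"
    if k: "k \<in> {1..T}" for k
  proof
    show "convex_on UNIV (g k)" "convex_on UNIV (h k)"
      using losses k unfolding composite_losses_def by auto
    show "lipschitz_gradient L (g k)"
      using losses k Lk[OF k] lipschitz_gradient_mono unfolding composite_losses_def by blast
    show "B-lipschitz_on UNIV (h k)"
      using losses k Bk[OF k] lipschitz_on_le unfolding composite_losses_def by blast
    show "norm (x k - y k) \<le> \<epsilon> k"
      using alg k unfolding inexact_online_pmd_def by blast
    have "is_arg_min (\<lambda>z. h k z + (grad (g k) (x (k - 1)) + e k) \<bullet> z
          + (1 / lam) * bregman \<omega> z (x (k - 1))) (\<lambda>z. z \<in> UNIV) (y k)"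
      using alg k unfolding inexact_online_pmd_def by blast
    then show "h k (y k) + ((grad (g k) (x (k - 1)) + e k) \<bullet> y k + (1 / lam) * bregman \<omega> (y k) (x (k - 1)))
        \<le> h k z + ((grad (g k) (x (k - 1)) + e k) \<bullet> z + (1 / lam) * bregman \<omega> z (x (k - 1)))" for z
      unfolding is_arg_min_linorder by (simp add: add.assoc)
    show "h k (xstar k) + g k (xstar k) \<le> h k z + g k z" for z
      using opt[OF k] unfolding is_arg_min_linorder by (simp add: add.commute)
  qed (use \<omega> pos in auto)
  have error_term: "proximal_step.error_term (\<epsilon> k) (e k) (x (k - 1)) (x k) (xstar k) (xstar (k - 1)) = w k"
    and perturbation: "proximal_step.perturbation (\<epsilon> k) (e k) (xstar k) (xstar (k - 1)) = q k"
    if "k \<in> {1..T}" for k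
    unfolding proximal_step.error_term_def[OF round[OF that]]
      proximal_step.perturbation_def[OF round[OF that]] w_def q_def r_def by simp_all
  have G: "0 \<le> G" by (rule lipschitz_gradient_nonneg[OF \<omega>(2)])
  have B: "0 \<le> B" by (rule proximal_step.B_nonneg[OF round[of 1]]) (use \<open>1 \<le> T\<close> in simp)
  have c: "0 < c" unfolding c_def using stepsize by linarith
  have q: "0 \<le> q k" if "k \<in> {1..T}" for k
    using proximal_step.eps_nonneg[OF round[OF that]] unfolding q_def by simp
  have a0: "a 0 \<le> A"
  proof -
    have "a 0 \<le> G / 2 * (norm (xstar 0 - x 0))\<^sup>2"
      unfolding a_def by (rule bregman_le[OF \<omega>(2)])
    also have "\<dots> \<le> G / 2 * D\<^sup>2"
      using init G by (intro mult_left_mono power_mono) (auto simp: norm_minus_commute)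
    finally show ?thesis by (simp add: A_def)
  qed
  have lower: "\<sigma> / 2 * (r k)\<^sup>2 \<le> a k" for k
    unfolding r_def a_def norm_minus_commute[of "x k"] by (rule bregman_ge[OF \<omega>])
  have step: "a k + c * d k \<le> a (k - 1) + K * w k" if "k \<in> {1..T}" for k
    using proximal_step.contraction[OF round[OF that], of "xstar (k - 1)"]
    unfolding a_def c_def d_def K_def error_term[OF that] .
  note drift_premises = step[unfolded w_def] lower a0
  have W: "(\<Sum>k=1..T. w k) \<le> Z * (1 + Q\<^sup>2)"
    unfolding Z_def Q_def w_def
    by (rule self_bounding_drift(1)[where a = a and d = d and c = c])
      (use drift_premises q pos G c in \<open>auto simp: d_def r_def K_def\<close>)
  have "c * (\<Sum>k=1..T. d k) \<le> A + K * (\<Sum>k=1..T. w k)"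
    unfolding w_def
    by (rule self_bounding_drift(2)[where a = a and \<alpha> = "\<sigma> / 2"])
      (use drift_premises q pos G c in \<open>auto simp: d_def r_def K_def\<close>)
  also have "\<dots> \<le> A + K * (Z * (1 + Q\<^sup>2))"
    using W G pos by (intro add_left_mono mult_left_mono) (auto simp: K_def)
  also have "\<dots> \<le> (A + K * Z) * (1 + Q\<^sup>2)"
    using G by (simp add: A_def algebra_simps)
  finally have d: "(\<Sum>k=1..T. d k) \<le> (A + K * Z) / c * (1 + Q\<^sup>2)"
    using c by (simp add: pos_le_divide_eq mult.commute)
  have "0 \<le> (Q - 1)\<^sup>2" "0 \<le> Q\<^sup>2" by simp_all
  then have Q: "Q \<le> 1 + Q\<^sup>2"
    unfolding power2_diff power_one mult_1_right by linarith
  have "(\<Sum>k=1..T. (g k (x k) + h k (x k)) - (g k (xstar k) + h k (xstar k)))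
      \<le> (\<Sum>k=1..T. (a (k - 1) - a k) / lam + L / 2 * d k + (G / lam + 1 + L) * w k + 2 * B * q k)"
  proof (rule sum_mono)
    fix k assume k: "k \<in> {1..T}"
    show "(g k (x k) + h k (x k)) - (g k (xstar k) + h k (xstar k))
        \<le> (a (k - 1) - a k) / lam + L / 2 * d k + (G / lam + 1 + L) * w k + 2 * B * q k"
      using proximal_step.regret[OF round[OF k], of "xstar (k - 1)"]
      unfolding a_def d_def error_term[OF k] perturbation[OF k] .
  qed
  also have "\<dots> = (a 0 - a T) / lam + L / 2 * (\<Sum>k=1..T. d k)
      + (G / lam + 1 + L) * (\<Sum>k=1..T. w k) + 2 * B * Q"
    by (simp only: sum.distrib sum_distrib_left[symmetric] sum_divide_distrib[symmetric]
        sum_telescope_pred Q_def)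
  also have "\<dots> \<le> A / lam * (1 + Q\<^sup>2) + L / 2 * ((A + K * Z) / c * (1 + Q\<^sup>2))
      + (G / lam + 1 + L) * (Z * (1 + Q\<^sup>2)) + 2 * B * (1 + Q\<^sup>2)"
  proof (intro add_mono mult_left_mono d W Q)
    have "0 \<le> \<sigma> / 2 * (r T)\<^sup>2" using pos by simp
    then have "a 0 - a T \<le> A" using lower[of T] a0 by linarith
    then have "(a 0 - a T) / lam \<le> A / lam" using pos by (simp add: divide_right_mono)
    also have "\<dots> \<le> A / lam * (1 + Q\<^sup>2)"
      using G pos by (simp add: A_def distrib_left)
    finally show "(a 0 - a T) / lam \<le> A / lam * (1 + Q\<^sup>2)" .
  qed (use pos G B in auto)
  also have "\<dots> = regret_constant lam L B \<sigma> G D * (1 + Q\<^sup>2)"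
    unfolding regret_constant_def Let_def A_def[symmetric] K_def[symmetric] c_def[symmetric]
      Z_def[symmetric] by (simp only: distrib_right mult.assoc)
  finally show ?thesis unfolding Q_def .
qed

section \<open>The dynamic regret bound\<close>

theorem theorem2p2:
  fixes \<Omega> :: "(real ^ 'n) set"
    and lam L B \<sigma> G D :: real
  assumes "\<Omega> = UNIV"
    and "0 < \<sigma>" and "0 < lam" and "lam * L < 2 * \<sigma>"
  shows "\<exists>C. \<forall>T g h Lk Bk \<omega> e \<epsilon> y x xstar.
     1 \<le> T
     \<longrightarrow> composite_losses T g h Lk Bk
     \<longrightarrow> Max (Lk ` {1..T}) = L \<longrightarrow> Max (Bk ` {1..T}) = B
     \<longrightarrow> strongly_convex \<sigma> \<omega> \<longrightarrow> lipschitz_gradient G \<omega>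
     \<longrightarrow> inexact_online_pmd \<Omega> lam \<omega> T g h e \<epsilon> y x
     \<longrightarrow> xstar 0 \<in> \<Omega>
     \<longrightarrow> (\<forall>k\<in>{1..T}. is_arg_min (\<lambda>z. g k z + h k z) (\<lambda>z. z \<in> \<Omega>) (xstar k))
     \<longrightarrow> norm (x 0 - xstar 0) \<le> D
     \<longrightarrow> (let R = (\<Sum>k=1..T. (g k (x k) + h k (x k)) - (g k (xstar k) + h k (xstar k)));
              S = (\<Sum>k=1..T. norm (xstar k - xstar (k - 1)));
              S2 = (\<Sum>k=1..T. (norm (xstar k - xstar (k - 1)))\<^sup>2);
              E = (\<Sum>k=1..T. norm (e k));
              P = (\<Sum>k=1..T. \<epsilon> k)
          in \<bar>R\<bar> \<le> C * (1 + P + S2 + (E + P + S)\<^sup>2))"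
proof -
  \<comment> \<open>Co-coercivity divides by the gradient modulus, and \<open>L\<close> may be 0; the modulus \<open>\<sigma> / lam\<close>
      is positive and satisfies the step-size condition.\<close>
  define L' where "L' = max L (\<sigma> / lam)"
  have L': "0 < L'" "L \<le> L'" "lam * L' < 2 * \<sigma>"
    using assms by (auto simp: L'_def less_max_iff_disj) (auto simp: max_def)
  define C where "C = \<bar>regret_constant lam L' B \<sigma> G D\<bar>"
  show ?thesis
  proof (rule exI[of _ C], intro allI impI)
    fix T :: nat and g h :: "nat \<Rightarrow> real ^ 'n \<Rightarrow> real" and Lk Bk \<epsilon> :: "nat \<Rightarrow> real"
      and \<omega> :: "real ^ 'n \<Rightarrow> real" and e y x xstar :: "nat \<Rightarrow> real ^ 'n"
    assume T: "1 \<le> T" and losses: "composite_losses T g h Lk Bk"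
      and L: "Max (Lk ` {1..T}) = L" and B: "Max (Bk ` {1..T}) = B"
      and \<omega>: "strongly_convex \<sigma> \<omega>" "lipschitz_gradient G \<omega>"
      and alg: "inexact_online_pmd \<Omega> lam \<omega> T g h e \<epsilon> y x"
      and opt: "\<forall>k\<in>{1..T}. is_arg_min (\<lambda>z. g k z + h k z) (\<lambda>z. z \<in> \<Omega>) (xstar k)"
      and init: "norm (x 0 - xstar 0) \<le> D"
    define R where "R = (\<Sum>k=1..T. (g k (x k) + h k (x k)) - (g k (xstar k) + h k (xstar k)))"
    define S where "S = (\<Sum>k=1..T. norm (xstar k - xstar (k - 1)))"
    define S2 where "S2 = (\<Sum>k=1..T. (norm (xstar k - xstar (k - 1)))\<^sup>2)"
    define E where "E = (\<Sum>k=1..T. norm (e k))"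
    define P where "P = (\<Sum>k=1..T. \<epsilon> k)"
    have "Lk k \<le> L'" "Bk k \<le> B" if "k \<in> {1..T}" for k
      using that L B L'(2) Max_ge[of "Lk ` {1..T}" "Lk k"] Max_ge[of "Bk ` {1..T}" "Bk k"] by auto
    then have "R \<le> regret_constant lam L' B \<sigma> G D
        * (1 + (\<Sum>k=1..T. norm (e k) + \<epsilon> k + norm (xstar k - xstar (k - 1)))\<^sup>2)"
      unfolding R_def using T losses \<omega> alg opt init assms L'
      by (intro dynamic_regret_bound[where y = y and Lk = Lk and Bk = Bk and \<omega> = \<omega>]) auto
    then have "R \<le> regret_constant lam L' B \<sigma> G D * (1 + (E + P + S)\<^sup>2)"
      by (simp add: E_def P_def S_def sum.distrib)
    also have "\<dots> \<le> C * (1 + (E + P + S)\<^sup>2)"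
      unfolding C_def by (intro mult_right_mono) auto
    also have "\<dots> \<le> C * (1 + P + S2 + (E + P + S)\<^sup>2)"
    proof (rule mult_left_mono)
      have "0 \<le> P"
        using alg unfolding P_def inexact_online_pmd_def by (intro sum_nonneg) (auto simp: less_imp_le)
      moreover have "0 \<le> S2" unfolding S2_def by (intro sum_nonneg) auto
      ultimately show "1 + (E + P + S)\<^sup>2 \<le> 1 + P + S2 + (E + P + S)\<^sup>2" by simp
    qed (simp add: C_def)
    finally have "R \<le> C * (1 + P + S2 + (E + P + S)\<^sup>2)" .
    moreover have "0 \<le> R"
      unfolding R_def using opt assms(1) by (intro sum_nonneg) (auto simp: is_arg_min_linorder)
    ultimately show "let R = (\<Sum>k=1..T. (g k (x k) + h k (x k)) - (g k (xstar k) + h k (xstar k)));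
              S = (\<Sum>k=1..T. norm (xstar k - xstar (k - 1)));
              S2 = (\<Sum>k=1..T. (norm (xstar k - xstar (k - 1)))\<^sup>2);
              E = (\<Sum>k=1..T. norm (e k));
              P = (\<Sum>k=1..T. \<epsilon> k)
          in \<bar>R\<bar> \<le> C * (1 + P + S2 + (E + P + S)\<^sup>2)"
      unfolding Let_def R_def S_def S2_def E_def P_def by linarith
  qed
qed

end
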